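(* Let $P_d\in\mathbb{Z}$ with $P_d\ge 1$, let $\chi_0\ge 0$, and let $g_0:\mathbb{Z}\to\mathbb{R}$ satisfy: $g_0(t)=0$ for $t<0$, $g_0(0)>0$, $\sum_{t}|g_0(t)|<\infty$, the support of $g_0$ is $\{0,1,2,\dots\}$, and $g_0$ is strictly monotonically decreasing on its support. Consider the system $$u(t)=-\mathcal{C}_{g_0}(\mathrm{rel}_{\chi_0}(u))(t-P_d),\qquad t\in\mathbb{Z}.\qquad(\ast)$$ (1) Let $u$ be any self-oscillation of $(\ast)$ of period $P\ge P_d$ (i.e. $u$ is $P$-periodic, satisfies $(\ast)$, and $S_c^-(\Delta_c u^P)\ge 2$) such that $S_c^-(\Delta_c u^P)=2$ and $S_c^+(\mathrm{rel}_{\chi_0}(u^P))=2$. Then $$2P_d\le P\le 2(P_d+P_s),$$ where $P_s$ is the smallest $t\in\mathbb{Z}_{\ge 0}$ for which $\sum_{k=0}^{t-1}g_0(k)-\sum_{k=t}^{\infty}g_0(k)>0$. (2) Let $s:\mathbb{Z}\to\mathbb{R}$ be the $2P_d$-periodic sequence with $s(t)=1$ for $0\le t\le P_d-1$ and $s(t)=-1$ for $P_d\le t\le 2P_d-1$. There is a $2P_d$-periodic self-oscillation $u$ of $(\ast)$ with $\mathrm{rel}_{\chi_0}(u)=s$, i.e. $\mathrm{rel}_{\chi_0}(u^{2P_d})=[\mathbf{1}_{P_d}^\top,-\mathbf{1}_{P_d}^\top]^\top$, if and only if $$\mathcal{C}_{g_0}(s)(0)>\chi_0.$$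
   Context: Convolution operator: $\mathcal{C}_{g_0}(x)(t)=\sum_{\tau\in\mathbb{Z}}g_0(t-\tau)x(\tau)$ for bounded $x:\mathbb{Z}\to\mathbb{R}$. Support: $\mathrm{supp}(g_0)=\{i\in\mathbb{Z}: g_0(i)\neq 0\}$. $\mathbf{1}_n\in\mathbb{R}^n$ is the all-ones vector. Truncation: for a $P$-periodic sequence $x$, $x^P=[x(0),\dots,x(P-1)]^\top\in\mathbb{R}^P$. Relay with dead zone: for $\chi_0\ge 0$ and $x\in\mathbb{R}$, $\mathrm{rel}_{\chi_0}(x)=1$ if $x>\chi_0$, $-1$ if $x<-\chi_0$, and $0$ otherwise; applied entrywise to vectors and sequences. Cyclic forward difference: for $v\in\mathbb{R}^n$, $\Delta_c v=[v_2-v_1,\,v_3-v_2,\dots,v_n-v_{n-1},\,v_1-v_n]^\top$. Variation: for $v\neq 0$, $S^-(v)$ is the number of sign changes between consecutive entries of the vector obtained from $v$ by deleting all zeros; $S^-(0)=-1$. Cyclic variation: $S_c^-(v)=\max_{1\le i\le n}S^-([v_i,\dots,v_n,v_1,\dots,v_i])$. $S_c^+(v)$ is the maximum of $S_c^-(\bar v)$ over all $\bar v\in\mathbb{R}^n$ obtained from $v$ by replacing its zero entries by arbitrary real numbers. Self-oscillation: a $P$-periodic sequence $u$ (for some $P\in\mathbb{Z}_{>0}$) satisfying $(\ast)$ with $S_c^-(\Delta_c u^P)\ge 2$. *)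

theory Defs
  imports "HOL-Analysis.Infinite_Sum"
begin

text \<open>Sequences are functions on \<^typ>\<open>int\<close>; vectors in $R^n$ are real lists of length $n$,
  indexed from 0.\<close>

definition conv :: "(int \<Rightarrow> real) \<Rightarrow> (int \<Rightarrow> real) \<Rightarrow> int \<Rightarrow> real" where
  "conv g x t = (\<Sum>\<^sub>\<infinity>\<tau>\<in>UNIV. g (t - \<tau>) * x \<tau>)"

definition supp :: "(int \<Rightarrow> real) \<Rightarrow> int set" where
  "supp g = {i. g i \<noteq> 0}"

definition rel :: "real \<Rightarrow> real \<Rightarrow> real" where
  "rel \<chi> x = (if x > \<chi> then 1 else if x < - \<chi> then -1 else 0)"

text \<open>The period need not be minimal.\<close>

definition periodic :: "int \<Rightarrow> (int \<Rightarrow> real) \<Rightarrow> bool" where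
  "periodic P x \<longleftrightarrow> P > 0 \<and> (\<forall>t. x (t + P) = x t)"

definition trunc :: "int \<Rightarrow> (int \<Rightarrow> real) \<Rightarrow> real list" where
  "trunc P x = map x [0..P - 1]"

definition cyc_diff :: "real list \<Rightarrow> real list" where
  "cyc_diff v = map (\<lambda>i. v ! (Suc i mod length v) - v ! i) [0..<length v]"

definition sign_changes :: "real list \<Rightarrow> nat" where
  "sign_changes w = card {i. Suc i < length w \<and> sgn (w ! i) \<noteq> sgn (w ! Suc i)}"

definition var_minus :: "real list \<Rightarrow> int" where
  "var_minus v =
     (if \<forall>x\<in>set v. x = 0 then -1 else int (sign_changes (filter (\<lambda>x. x \<noteq> 0) v)))"

definition cvar_minus :: "real list \<Rightarrow> int" where
  "cvar_minus v = Max ((\<lambda>i. var_minus (rotate i v @ [v ! i])) ` {..<length v})"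

text \<open>For nonempty \<open>v\<close>, the set below is a nonempty set of integers between $-1$ and the length
  of \<open>v\<close>, so that \<^const>\<open>Max\<close> is the actual maximum although infinitely many \<open>w\<close> occur.\<close>

definition cvar_plus :: "real list \<Rightarrow> int" where
  "cvar_plus v = Max {cvar_minus w | w.
     length w = length v \<and> (\<forall>i<length v. v ! i \<noteq> 0 \<longrightarrow> w ! i = v ! i)}"

definition relay_feedback :: "(int \<Rightarrow> real) \<Rightarrow> real \<Rightarrow> int \<Rightarrow> (int \<Rightarrow> real) \<Rightarrow> bool" where
  "relay_feedback g \<chi> Pd u \<longleftrightarrow> (\<forall>t. u t = - conv g (\<lambda>\<tau>. rel \<chi> (u \<tau>)) (t - Pd))"

definition self_oscillation ::
    "(int \<Rightarrow> real) \<Rightarrow> real \<Rightarrow> int \<Rightarrow> int \<Rightarrow> (int \<Rightarrow> real) \<Rightarrow> bool" where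
  "self_oscillation g \<chi> Pd P u \<longleftrightarrow>
     periodic P u \<and> relay_feedback g \<chi> Pd u \<and> cvar_minus (cyc_diff (trunc P u)) \<ge> 2"

definition settle_time :: "(int \<Rightarrow> real) \<Rightarrow> int" where
  "settle_time g =
     (LEAST t. 0 \<le> t \<and> (\<Sum>k\<in>{0..t - 1}. g k) - (\<Sum>\<^sub>\<infinity>k\<in>{t..}. g k) > 0)"

end

theory Submission
  imports Defs "HOL-Library.Sublist"
begin

text \<open>Write \<open>r\<close> for the relay output, so that \<open>u t = - conv g r (t - d)\<close> with the delay \<open>d\<close>. Two
  observations carry the proof.

  The first is analytic. Summation by parts (\<open>conv_increment\<close>) gives
  \<open>conv g r t - conv g r (t - 1) = (\<Sum>m. (g m - g (m + 1)) * (r t - r (t - 1 - m)))\<close>,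
  where the differences of \<open>g\<close> are positive for \<open>m \<ge> 0\<close>. An oscillation makes \<open>r\<close> take both
  values 1 and -1 in every period. Therefore the output strictly rises at every time at which \<open>r\<close>
  equals 1 and strictly falls at every time at which it equals -1.

  The second is combinatorial. Zeros of \<open>r\<close> may take any sign in \<open>cvar_plus\<close>, so \<open>cvar_plus = 2\<close>
  forbids four places in cyclic order at which \<open>r\<close> is \<open>\<ge> 0\<close>, \<open>\<le> 0\<close>, \<open>\<ge> 0\<close>, \<open>\<le> 0\<close>
  (\<open>cvar_plus_trunc_ge_of_alternation\<close>).

  Lower bound on the period \<open>P \<ge> d\<close>: by the first observation, \<open>d\<close> steps before a maximum of \<open>u\<close>
  the relay output goes from \<open>\<le> 0\<close> to \<open>\<ge> 0\<close>, and \<open>d\<close> steps before a minimum it goes from \<open>\<ge> 0\<close>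
  to \<open>\<le> 0\<close>. If \<open>2 * d\<close> exceeded \<open>P\<close>, one of these two pieces of length \<open>d\<close> would reach back
  beyond the preceding extremum, and the switch at its beginning would form a forbidden pattern
  with the two extrema. Upper bound: after a run of ones of the length of the settling time the
  output is positive, so the delayed feedback ends the run at most \<open>d\<close> steps later; the same
  holds for minus ones, and between the two runs the second observation leaves room for one
  entry at most.

  For the square wave, antiperiodicity turns the delayed negative feedback into \<open>u = conv g s\<close>.
  By the first observation this \<open>u\<close> increases along the ones of \<open>s\<close>, so the threshold condition
  has to be checked at time 0 only.\<close>

section \<open>Sign changes\<close>

lemma sign_changes_Cons_Cons:
  "sign_changes (x # y # ys) = (if sgn x \<noteq> sgn y then 1 else 0) + sign_changes (y # ys)"
proof -
  let ?A = "{i. Suc i < length (x # y # ys) \<and> sgn ((x # y # ys) ! i) \<noteq> sgn ((x # y # ys) ! Suc i)}"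
  let ?B = "{i. Suc i < length (y # ys) \<and> sgn ((y # ys) ! i) \<noteq> sgn ((y # ys) ! Suc i)}"
  have "?A = (if sgn x \<noteq> sgn y then {0} else {}) \<union> Suc ` ?B" (is "_ = ?C")
  proof (rule set_eqI)
    fix i
    show "i \<in> ?A \<longleftrightarrow> i \<in> ?C"
      by (cases i) auto
  qed
  moreover have "card ?C = (if sgn x \<noteq> sgn y then 1 else 0) + card ?B"
    by (subst card_Un_disjoint) (auto simp: card_image)
  ultimately show ?thesis
    by (simp only: sign_changes_def)
qed

lemma sign_changes_short [simp]: "sign_changes [] = 0" "sign_changes [x] = 0"
  by (simp_all add: sign_changes_def)

lemma sign_changes_le_length: "sign_changes w \<le> length w"
proof -
  have "sign_changes w \<le> card {..<length w}"
    unfolding sign_changes_def by (rule card_mono) auto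
  then show ?thesis by simp
qed

lemma sign_changes_Cons_le: "sign_changes ys \<le> sign_changes (y # ys)"
  by (cases ys) (simp_all add: sign_changes_Cons_Cons)

text \<open>Triangle inequality for the discrete metric on signs: replacing the head changes the count
  by at most one, and only if the sign of the head changes.\<close>

lemma sign_changes_Cons_swap:
  "sign_changes (x # ys) \<le> (if sgn x \<noteq> sgn y then 1 else 0) + sign_changes (y # ys)"
  by (cases ys) (auto simp: sign_changes_Cons_Cons)

text \<open>Deleting an entry merges two adjacent comparisons into one, so by the triangle inequality it
  creates no sign change. The induction needs the statement under an arbitrary common head
  as well, because the first entry kept may be compared with something further left.\<close>

lemma sign_changes_subseq:
  assumes "subseq xs ys"
  shows "sign_changes xs \<le> sign_changes ys"
proof -
  have "sign_changes xs \<le> sign_changes ys \<and> (\<forall>z. sign_changes (z # xs) \<le> sign_changes (z # ys))"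
    using assms
  proof (induction rule: list_emb.induct)
    case (list_emb_Nil ys)
    then show ?case by simp
  next
    case (list_emb_Cons xs ys y)
    have "sign_changes (z # xs) \<le> sign_changes (z # y # ys)" for z
    proof -
      have "sign_changes (z # xs) \<le> (if sgn z \<noteq> sgn y then 1 else 0) + sign_changes (y # xs)"
        by (rule sign_changes_Cons_swap)
      also have "\<dots> \<le> (if sgn z \<noteq> sgn y then 1 else 0) + sign_changes (y # ys)"
        using list_emb_Cons.IH by simp
      finally show ?thesis by (simp add: sign_changes_Cons_Cons)
    qed
    moreover have "sign_changes xs \<le> sign_changes (y # ys)"
      using list_emb_Cons.IH sign_changes_Cons_le order_trans by blast
    ultimately show ?case by blast
  next
    case (list_emb_Cons2 x y xs ys)
    then show ?case by (simp add: sign_changes_Cons_Cons)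
  qed
  then show ?thesis by blast
qed

lemma subseq_map_nth:
  assumes "sorted_wrt (<) ps" and "\<forall>p\<in>set ps. p < length v"
  shows "subseq (map ((!) v) ps) v"
proof -
  have "ps = filter (\<lambda>p. p \<in> set ps) [0..<length v]"
    by (rule sorted_distinct_set_unique)
      (use assms in \<open>auto simp: strict_sorted_iff sorted_wrt_filter\<close>)
  then have "subseq ps [0..<length v]"
    by (metis subseq_filter_left)
  then have "subseq (map ((!) v) ps) (map ((!) v) [0..<length v])"
    by (rule subseq_map)
  then show ?thesis by (simp add: map_nth)
qed

text \<open>The tool for bounding a variation from below: it suffices to exhibit a few nonzero entries
  in their order, since the entries in between can only add sign changes.\<close>

lemma sign_changes_le_var_minus:
  assumes "subseq xs v" and "0 \<notin> set xs" and "xs \<noteq> []"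
  shows "int (sign_changes xs) \<le> var_minus v"
proof -
  have "subseq (filter (\<lambda>x. x \<noteq> 0) xs) (filter (\<lambda>x. x \<noteq> 0) v)"
    using assms(1) by (rule subseq_filter)
  moreover have "filter (\<lambda>x. x \<noteq> 0) xs = xs"
    using assms(2) by (induction xs) auto
  moreover have "\<not> (\<forall>x\<in>set v. x = 0)"
  proof -
    have "hd xs \<in> set xs" using assms(3) by simp
    moreover from list_emb_set[OF assms(1) this] have "hd xs \<in> set v" by auto
    ultimately show ?thesis using assms(2) by metis
  qed
  ultimately show ?thesis
    by (auto simp: var_minus_def intro: sign_changes_subseq)
qed

lemma var_minus_bounds: "-1 \<le> var_minus v" "var_minus v \<le> int (length v)"
proof -
  show "-1 \<le> var_minus v" by (simp add: var_minus_def)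
  have "sign_changes (filter (\<lambda>x. x \<noteq> 0) v) \<le> length v"
    using sign_changes_le_length length_filter_le le_trans by blast
  then show "var_minus v \<le> int (length v)" by (auto simp: var_minus_def)
qed

lemma cvar_minus_bounds:
  assumes "v \<noteq> []"
  shows "-1 \<le> cvar_minus v" "cvar_minus v \<le> int (length v) + 1"
proof -
  let ?A = "(\<lambda>i. var_minus (rotate i v @ [v ! i])) ` {..<length v}"
  have "Max ?A \<in> ?A" using assms by (intro Max_in) auto
  then obtain i where "cvar_minus v = var_minus (rotate i v @ [v ! i])"
    unfolding cvar_minus_def by blast
  then show "-1 \<le> cvar_minus v" "cvar_minus v \<le> int (length v) + 1"
    using var_minus_bounds[of "rotate i v @ [v ! i]"] by simp_all
qed

lemma var_minus_le_cvar_minus: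
  "i < length v \<Longrightarrow> var_minus (rotate i v @ [v ! i]) \<le> cvar_minus v"
  unfolding cvar_minus_def by (rule Max_ge) auto

text \<open>The maximum defining \<^const>\<open>cvar_plus\<close> ranges over an infinite family; it dominates each
  member because the values are integers in a bounded range.\<close>

lemma cvar_minus_le_cvar_plus:
  assumes "v \<noteq> []" "length w = length v" "\<And>i. i < length v \<Longrightarrow> v ! i \<noteq> 0 \<Longrightarrow> w ! i = v ! i"
  shows "cvar_minus w \<le> cvar_plus v"
proof -
  let ?A = "{cvar_minus w | w. length w = length v \<and> (\<forall>i<length v. v ! i \<noteq> 0 \<longrightarrow> w ! i = v ! i)}"
  have "?A \<subseteq> {-1..int (length v) + 1}"
  proof clarify
    fix w :: "real list" assume "length w = length v"
    with assms(1) have "w \<noteq> []" "length w = length v" by auto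
    then show "cvar_minus w \<in> {-1..int (length v) + 1}"
      using cvar_minus_bounds[of w] by auto
  qed
  then have "finite ?A" using finite_subset by blast
  then show ?thesis
    unfolding cvar_plus_def by (rule Max_ge) (use assms in auto)
qed

text \<open>Zeros may be replaced at will, so weak inequalities are enough: a zero at one of the four
  places is given the sign that the alternating pattern asks for. Three sign changes are then
  visible without closing the vector up cyclically.\<close>

lemma cvar_plus_ge_of_alternation:
  fixes \<sigma> :: real
  assumes "\<sigma> \<noteq> 0" and "a < b" "b < c" "c < d" "d < length v"
    and "0 \<le> \<sigma> * v ! a" "\<sigma> * v ! b \<le> 0" "0 \<le> \<sigma> * v ! c" "\<sigma> * v ! d \<le> 0"
  shows "3 \<le> cvar_plus v"
proof -
  define w where "w = map (\<lambda>i. if v ! i \<noteq> 0 then v ! i else if i \<in> {a, c} then \<sigma> else - \<sigma>)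
    [0..<length v]"
  have len: "length w = length v" by (simp add: w_def)
  have nth: "w ! i = (if v ! i \<noteq> 0 then v ! i else if i \<in> {a, c} then \<sigma> else - \<sigma>)"
    if "i < length v" for i using that by (simp add: w_def)
  have bounds: "a < length v" "b < length v" "c < length v" "d < length v" "b \<noteq> a" "b \<noteq> c" "d \<noteq> a" "d \<noteq> c"
    using assms(2-5) by simp_all
  have nz: "w ! i \<noteq> 0" if "i < length v" for i
    using assms(1) nth[OF that] by auto
  have pos: "sgn y = sgn \<sigma>" if "0 \<le> \<sigma> * y" "y \<noteq> 0" for y
    using that assms(1) by (auto simp: sgn_if zero_le_mult_iff)
  have neg: "sgn y = - sgn \<sigma>" if "\<sigma> * y \<le> 0" "y \<noteq> 0" for y
    using that assms(1) by (auto simp: sgn_if mult_le_0_iff)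
  have sgns: "sgn (w ! a) = sgn \<sigma>" "sgn (w ! b) = - sgn \<sigma>" "sgn (w ! c) = sgn \<sigma>" "sgn (w ! d) = - sgn \<sigma>"
    using bounds pos[OF assms(6)] neg[OF assms(7)] pos[OF assms(8)] neg[OF assms(9)]
    by (simp_all add: nth)
  let ?xs = "map ((!) w) [a, b, c, d]"
  have "subseq ?xs w"
    by (rule subseq_map_nth) (use assms(2-5) len in auto)
  moreover have "subseq w (w @ [w ! 0])"
    by (rule prefix_imp_subseq) simp
  ultimately have "subseq ?xs (rotate 0 w @ [w ! 0])"
    using subseq_order.order_trans[of ?xs w "w @ [w ! 0]"] by (simp only: rotate0 id_apply)
  moreover have "0 \<notin> set ?xs"
    using nz[OF bounds(1)] nz[OF bounds(2)] nz[OF bounds(3)] nz[OF bounds(4)] by simp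
  ultimately have "int (sign_changes ?xs) \<le> var_minus (rotate 0 w @ [w ! 0])"
    by (rule sign_changes_le_var_minus) simp
  moreover have "sgn \<sigma> \<noteq> - sgn \<sigma>"
    using assms(1) by (simp add: sgn_if)
  then have "sign_changes ?xs = 3"
    using \<open>sgn \<sigma> \<noteq> - sgn \<sigma>\<close> by (simp add: sign_changes_Cons_Cons sgns)
  moreover have "var_minus (rotate 0 w @ [w ! 0]) \<le> cvar_minus w"
    by (rule var_minus_le_cvar_minus) (use bounds len in linarith)
  moreover have "cvar_minus w \<le> cvar_plus v"
  proof (rule cvar_minus_le_cvar_plus[OF _ len])
    show "v \<noteq> []" using bounds(1) by auto
  qed (simp add: nth)
  ultimately show ?thesis by linarith
qed

section \<open>Periodic sequences\<close>

lemma periodic_add_mult: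
  assumes "periodic P x"
  shows "x (t + k * P) = x t"
proof (induction k rule: int_induct[where k = 0])
  case base
  then show ?case by simp
next
  case (step1 i)
  have "x (t + (i + 1) * P) = x ((t + i * P) + P)" by (simp add: algebra_simps)
  also have "\<dots> = x (t + i * P)" using assms by (simp only: periodic_def)
  finally show ?case using step1 by simp
next
  case (step2 i)
  have "x (t + (i - 1) * P) = x ((t + (i - 1) * P) + P)" using assms by (simp only: periodic_def)
  also have "\<dots> = x (t + i * P)" by (simp add: algebra_simps)
  finally show ?case using step2 by simp
qed

lemma periodic_mod:
  assumes "periodic P x"
  shows "x (t mod P) = x t"
  using periodic_add_mult[OF assms, of "t mod P" "t div P"] by simp

lemma shift_into_period:
  fixes P :: int
  assumes "0 < P"
  obtains k where "a \<le> t + k * P" "t + k * P < a + P"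
proof
  have "t + (- ((t - a) div P)) * P = a + (t - a) mod P"
    using mod_mult_div_eq[of "t - a" P] by (simp add: algebra_simps)
  then show "a \<le> t + (- ((t - a) div P)) * P" "t + (- ((t - a) div P)) * P < a + P"
    using assms by simp_all
qed

lemma length_trunc [simp]: "length (trunc P x) = nat P"
  by (simp add: trunc_def)

lemma nth_trunc [simp]: "i < nat P \<Longrightarrow> trunc P x ! i = x (int i)"
  by (simp add: trunc_def)

text \<open>The four places may lie anywhere within one period. Reduced modulo \<open>P\<close> they are a cyclic
  rotation of an increasing quadruple, and an odd rotation exchanges the roles of \<open>\<sigma>\<close> and \<open>-\<sigma>\<close>.
  This is why a sign \<open>\<sigma>\<close> is carried along.\<close>

lemma cvar_plus_trunc_ge_of_alternation:
  fixes \<sigma> :: real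
  assumes per: "periodic P r" and \<sigma>: "\<sigma> \<noteq> 0"
    and ord: "a < b" "b < c" "c < d" "d < a + P"
    and alt: "0 \<le> \<sigma> * r a" "\<sigma> * r b \<le> 0" "0 \<le> \<sigma> * r c" "\<sigma> * r d \<le> 0"
  shows "3 \<le> cvar_plus (trunc P r)"
proof -
  have P: "P > 0" using per by (simp add: periodic_def)
  have base: "3 \<le> cvar_plus (trunc P r)"
    if "\<rho> \<noteq> 0" "0 \<le> a" "a < b" "b < c" "c < d" "d < P"
      "0 \<le> \<rho> * r a" "\<rho> * r b \<le> 0" "0 \<le> \<rho> * r c" "\<rho> * r d \<le> 0" for \<rho> :: real and a b c d
    by (rule cvar_plus_ge_of_alternation[of \<rho> "nat a" "nat b" "nat c" "nat d"])
      (use that in \<open>auto simp: nat_less_iff\<close>)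
  define k where "k = a div P"
  define h where "h = (\<lambda>t. t - k * P)"
  have r1: "r (h t) = r t" for t
    using periodic_add_mult[OF per, of t "- k"] by (simp add: h_def)
  have r2: "r (h t - P) = r t" for t
    using periodic_add_mult[OF per, of t "- k - 1"] by (simp add: h_def algebra_simps)
  have ha: "0 \<le> h a" "h a < P"
    using P by (simp_all add: h_def k_def minus_div_mult_eq_mod)
  have ho: "h a < h b" "h b < h c" "h c < h d" "h d < h a + P"
    using ord by (simp_all add: h_def)
  have alt': "- \<sigma> * r a \<le> 0" "0 \<le> - \<sigma> * r b" "- \<sigma> * r c \<le> 0" "0 \<le> - \<sigma> * r d"
    using alt by simp_all
  have \<sigma>': "- \<sigma> \<noteq> 0" using \<sigma> by simp
  consider "h d < P" | "h c < P" "P \<le> h d" | "h b < P" "P \<le> h c" | "P \<le> h b" by linarith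
  then show ?thesis
  proof cases
    case 1
    show ?thesis
      by (rule base[OF \<sigma> ha(1) ho(1) ho(2) ho(3) 1]) (simp_all only: r1 alt)
  next
    case 2
    have "0 \<le> h d - P" "h d - P < h a" using 2 ho by linarith+
    then show ?thesis
      by (rule base[OF \<sigma>' _ _ ho(1) ho(2) 2(1)]) (simp_all only: r1 r2 alt')
  next
    case 3
    have "0 \<le> h c - P" "h c - P < h d - P" "h d - P < h a" using 3 ho by linarith+
    then show ?thesis
      by (rule base[OF \<sigma> _ _ _ ho(1) 3(1)]) (simp_all only: r1 r2 alt)
  next
    case 4
    have "0 \<le> h b - P" "h b - P < h c - P" "h c - P < h d - P" "h d - P < h a"
      using 4 ho by linarith+
    then show ?thesis
      by (rule base[OF \<sigma>' _ _ _ _ ha(2)]) (simp_all only: r1 r2 alt')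
  qed
qed

lemma cvar_minus_cyc_diff_trunc_zero:
  assumes "P > 0" "\<And>t. x t = 0"
  shows "cvar_minus (cyc_diff (trunc P x)) = -1"
proof -
  define v where "v = cyc_diff (trunc P x)"
  have len: "length v = nat P" by (simp add: v_def cyc_diff_def)
  have "trunc P x ! i = 0" if "i < nat P" for i
    using that assms by simp
  then have z: "y = 0" if "y \<in> set v" for y
    using that assms(1) by (auto simp: v_def cyc_diff_def)
  have "var_minus (rotate i v @ [v ! i]) = -1" if "i < length v" for i
    using z that by (auto simp: var_minus_def)
  then have "(\<lambda>i. var_minus (rotate i v @ [v ! i])) ` {..<length v} = (\<lambda>i. -1) ` {..<length v}"
    by (intro image_cong) auto
  also have "\<dots> = {-1}"
    using len assms(1) by (simp add: image_constant_conv lessThan_empty_iff)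
  finally have "(\<lambda>i. var_minus (rotate i v @ [v ! i])) ` {..<length v} = {-1}" .
  then show ?thesis by (simp add: cvar_minus_def flip: v_def)
qed

lemma nth_cyc_diff_trunc:
  assumes "periodic P x" "i < nat P"
  shows "cyc_diff (trunc P x) ! i = x (int i + 1) - x (int i)"
proof -
  have P: "P > 0" using assms by (simp add: periodic_def)
  have "Suc i mod nat P < nat P" using P by simp
  then have "trunc P x ! (Suc i mod nat P) = x (int (Suc i mod nat P))" by (rule nth_trunc)
  also have "\<dots> = x ((int i + 1) mod P)" using P by (simp add: zmod_int add.commute)
  also have "\<dots> = x (int i + 1)" by (rule periodic_mod[OF assms(1)])
  finally show ?thesis using assms(2) by (simp add: cyc_diff_def)
qed

text \<open>One descent and one ascent within a period already give two cyclic sign changes of the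
  differences: rotate the vector of differences so that it begins, and hence also ends, with the
  descent.\<close>

lemma cvar_minus_cyc_diff_trunc_ge:
  assumes per: "periodic P x"
    and a: "0 \<le> a" "a < P" "x (a + 1) < x a"
    and b: "a < b" "b < a + P" "x b < x (b + 1)"
  shows "2 \<le> cvar_minus (cyc_diff (trunc P x))"
proof -
  define v where "v = cyc_diff (trunc P x)"
  have P: "P > 0" using per by (simp add: periodic_def)
  have len: "length v = nat P" by (simp add: v_def cyc_diff_def)
  define i where "i = nat a"
  define w where "w = rotate i v @ [v ! i]"
  have i: "i < length v" using a len by (simp add: i_def nat_less_iff)
  have w: "w ! k = x (a + int k + 1) - x (a + int k)" if "k < nat P" for k
  proof -
    have "w ! k = v ! ((i + k) mod nat P)"
      using that len by (simp add: w_def nth_append nth_rotate add.commute)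
    also have "\<dots> = x (int ((i + k) mod nat P) + 1) - x (int ((i + k) mod nat P))"
      unfolding v_def by (rule nth_cyc_diff_trunc[OF per]) (use P in simp)
    also have "int ((i + k) mod nat P) = (a + int k) mod P"
      using P a by (simp add: zmod_int i_def)
    also have "x ((a + int k) mod P + 1) = x (a + int k + 1)"
      by (metis periodic_mod[OF per] mod_add_left_eq)
    finally show ?thesis by (simp add: periodic_mod[OF per])
  qed
  have wP: "w ! nat P = v ! i"
    using len by (simp add: w_def nth_append)
  have "v ! i = x (a + 1) - x a"
    using nth_cyc_diff_trunc[OF per, of i] a i len by (simp add: v_def i_def)
  then have neg: "w ! 0 < 0" "w ! nat P < 0"
    using a w[of 0] P wP by simp_all
  have pos: "w ! nat (b - a) > 0"
    using b P w[of "nat (b - a)"] by (simp add: nat_less_iff algebra_simps)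
  let ?xs = "map ((!) w) [0, nat (b - a), nat P]"
  have "subseq ?xs w"
    by (rule subseq_map_nth) (use a b P len in \<open>auto simp: w_def\<close>)
  then have "int (sign_changes ?xs) \<le> var_minus w"
    using neg pos by (intro sign_changes_le_var_minus) (assumption, simp_all)
  moreover have "sign_changes ?xs = 2"
    using neg pos by (simp add: sign_changes_Cons_Cons)
  moreover have "var_minus w \<le> cvar_minus v"
    unfolding w_def by (rule var_minus_le_cvar_minus) (rule i)
  ultimately show ?thesis by (simp add: v_def)
qed

section \<open>Convolution with a decreasing causal kernel\<close>

lemma rel_uminus: "\<chi> \<ge> 0 \<Longrightarrow> rel \<chi> (- x) = - rel \<chi> x"
  by (simp add: rel_def)

lemma abs_rel_le_1: "\<bar>rel \<chi> x\<bar> \<le> 1"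
  by (simp add: rel_def)

text \<open>The form in which the kernel index is the summation variable; it turns a shift of the time
  into a shift of the signal.\<close>

lemma conv_altdef: "conv g x t = (\<Sum>\<^sub>\<infinity>k. g k * x (t - k))"
proof -
  have "bij_betw (\<lambda>k. t - k) UNIV UNIV"
    by (rule bij_betwI[of _ _ _ "\<lambda>k. t - k"]) auto
  from infsum_reindex_bij_betw[OF this, of "\<lambda>\<tau>. g (t - \<tau>) * x \<tau>"] show ?thesis
    by (simp add: conv_def)
qed

lemma conv_uminus: "conv g (\<lambda>\<tau>. - x \<tau>) t = - conv g x t"
  by (simp add: conv_altdef infsum_uminus)

lemma conv_shift: "conv g (\<lambda>\<tau>. x (\<tau> + c)) t = conv g x (t + c)"
  by (simp add: conv_altdef algebra_simps)

lemma periodic_conv: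
  assumes "periodic P x"
  shows "periodic P (conv g x)"
proof -
  have "(\<lambda>\<tau>. x (\<tau> + P)) = x" using assms by (auto simp: periodic_def)
  then have "conv g x (t + P) = conv g x t" for t
    using conv_shift[of g x P t] by simp
  then show ?thesis using assms by (simp add: periodic_def)
qed

lemma relay_feedback_uminus:
  assumes "\<chi> \<ge> 0" "relay_feedback g \<chi> d u"
  shows "relay_feedback g \<chi> d (\<lambda>t. - u t)"
  unfolding relay_feedback_def
proof
  fix t
  have "u t = - conv g (\<lambda>\<tau>. rel \<chi> (u \<tau>)) (t - d)"
    using assms(2) unfolding relay_feedback_def by blast
  then show "- u t = - conv g (\<lambda>\<tau>. rel \<chi> (- u \<tau>)) (t - d)"
    by (simp only: rel_uminus[OF assms(1)] conv_uminus)
qed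

locale decreasing_kernel =
  fixes g :: "int \<Rightarrow> real"
  assumes causal: "t < 0 \<Longrightarrow> g t = 0"
    and summable: "g summable_on UNIV"
    and decreasing: "0 \<le> t \<Longrightarrow> g (t + 1) < g t"
begin

lemma summable_on_mult:
  assumes "\<And>k. \<bar>x k\<bar> \<le> 1"
  shows "(\<lambda>k. g k * x k) summable_on A"
proof -
  have "(\<lambda>k. norm (g k)) summable_on UNIV"
    using summable by (rule summable_on_iff_abs_summable_on_real[THEN iffD1])
  then have "(\<lambda>k. norm (g k * x k)) summable_on UNIV"
    by (rule abs_summable_on_comparison_test') (use assms in \<open>auto simp: abs_mult intro: mult_left_le\<close>)
  then have "(\<lambda>k. g k * x k) summable_on UNIV"
    by (rule summable_on_iff_abs_summable_on_real[THEN iffD2])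
  then show ?thesis by (rule summable_on_subset_banach) simp
qed

text \<open>A strictly decreasing summable sequence tends to zero strictly from above.\<close>

lemma positive:
  assumes "0 \<le> t"
  shows "0 < g t"
proof -
  have "(\<lambda>n. g (int n)) summable_on UNIV"
  proof -
    have "g summable_on range int"
      using summable by (rule summable_on_subset_banach) simp
    then show ?thesis
      by (subst (asm) summable_on_reindex) (simp_all add: comp_def)
  qed
  then have "(\<lambda>n. g (int n)) \<longlonglongrightarrow> 0"
    by (intro summable_LIMSEQ_zero summable_on_imp_summable)
  moreover have "decseq (\<lambda>n. g (int n))"
  proof (rule decseq_SucI)
    show "g (int (Suc n)) \<le> g (int n)" for n
      using decreasing[of "int n"] by (simp add: add.commute)
  qed
  ultimately have "0 \<le> g (int (nat (t + 1)))"
    using decseq_ge by blast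
  with assms decreasing[OF assms] show ?thesis by simp
qed

lemma nonneg: "0 \<le> g t"
  using positive causal by (cases "t < 0") (auto simp: less_imp_le)

text \<open>Summation by parts for the increment of the output. Since the differences
  \<open>g m - g (m + 1)\<close> sum to zero over all integers, the constant \<open>x t\<close> can be inserted freely. The
  gain is that these differences are positive for \<open>m \<ge> 0\<close>, and that the only other nonzero one,
  at \<open>m = -1\<close>, is multiplied by \<open>x t - x t = 0\<close>.\<close>

lemma conv_increment:
  assumes x: "\<And>\<tau>. \<bar>x \<tau>\<bar> \<le> 1"
  shows "((\<lambda>m. (g m - g (m + 1)) * (x t - x (t - 1 - m))) has_sum conv g x t - conv g x (t - 1)) UNIV"
proof -
  have shift: "bij_betw (\<lambda>m::int. m + 1) UNIV UNIV"
    by (rule bij_betwI[of _ _ _ "\<lambda>m. m - 1"]) auto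
  have conv: "((\<lambda>k. g k * x (s - k)) has_sum conv g x s) UNIV" for s
    unfolding conv_altdef by (rule has_sum_infsum) (rule summable_on_mult, rule x)
  have old: "((\<lambda>m. g m * x (t - 1 - m)) has_sum conv g x (t - 1)) UNIV"
    by (rule conv)
  have new: "((\<lambda>m. g (m + 1) * x (t - 1 - m)) has_sum conv g x t) UNIV"
    using has_sum_reindex_bij_betw[OF shift, THEN iffD2, OF conv[of t]]
    by (simp add: diff_diff_eq add.commute)
  have total: "(g has_sum infsum g UNIV) UNIV"
    using summable by (rule has_sum_infsum)
  have total': "((\<lambda>m. g (m + 1)) has_sum infsum g UNIV) UNIV"
    using has_sum_reindex_bij_betw[OF shift, THEN iffD2, OF total] .
  have "((\<lambda>m. (g m + - g (m + 1)) * x t + (g (m + 1) * x (t - 1 - m) + - (g m * x (t - 1 - m))))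
          has_sum (infsum g UNIV + - infsum g UNIV) * x t + (conv g x t + - conv g x (t - 1))) UNIV"
    using old total'
    by (intro has_sum_add has_sum_cmult_left total new) (simp_all add: has_sum_uminus)
  then show ?thesis
    by (simp add: algebra_simps)
qed

text \<open>All terms of \<open>conv_increment\<close> are nonnegative where the input is at its maximum, and a
  smaller value in the past makes one of them positive.\<close>

lemma conv_less_at_max:
  assumes x: "\<And>\<tau>. \<bar>x \<tau>\<bar> \<le> 1" and max: "\<And>\<tau>. x \<tau> \<le> x t" and q: "q < t" "x q < x t"
  shows "conv g x (t - 1) < conv g x t"
proof -
  define f where "f = (\<lambda>m. (g m - g (m + 1)) * (x t - x (t - 1 - m)))"
  have f: "(f has_sum conv g x t - conv g x (t - 1)) UNIV"
    unfolding f_def by (rule conv_increment) (rule x)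
  have "0 \<le> f m" for m
  proof -
    consider "m < -1" | "m = -1" | "m \<ge> 0" by linarith
    then show ?thesis
      using max decreasing[of m] by cases (auto simp: f_def causal)
  qed
  then have "f (t - 1 - q) \<le> conv g x t - conv g x (t - 1)"
    using finite_sum_le_has_sum[OF f, of "{t - 1 - q}"] by simp
  moreover have "f (t - 1 - q) > 0"
    using q decreasing[of "t - 1 - q"] by (simp add: f_def)
  ultimately show ?thesis by simp
qed

lemma conv_greater_at_min:
  assumes x: "\<And>\<tau>. \<bar>x \<tau>\<bar> \<le> 1" and min: "\<And>\<tau>. x t \<le> x \<tau>" and q: "q < t" "x t < x q"
  shows "conv g x t < conv g x (t - 1)"
  using conv_less_at_max[of "\<lambda>\<tau>. - x \<tau>" t q] assms by (simp add: conv_uminus)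

text \<open>The settling time is a least integer, so it has its defining property only once some
  integer has it. One does because a finite part of the sum exceeds half of the total.\<close>

lemma settle_time_exceeds_tail:
  "0 \<le> settle_time g" (is ?nonneg)
  "(\<Sum>\<^sub>\<infinity>k\<in>{settle_time g..}. g k) < (\<Sum>k\<in>{0..settle_time g - 1}. g k)" (is ?ex)
proof -
  let ?Q = "\<lambda>t. 0 \<le> t \<and> (\<Sum>k\<in>{0..t - 1}. g k) - (\<Sum>\<^sub>\<infinity>k\<in>{t..}. g k) > 0"
  define S where "S = infsum g UNIV"
  have "0 < S"
    using finite_sum_le_infsum[OF summable, of "{0}"] nonneg positive[of 0] by (simp add: S_def)
  have split: "S = (\<Sum>k\<in>{0..t - 1}. g k) + (\<Sum>\<^sub>\<infinity>k\<in>{t..}. g k)" if "0 \<le> t" for t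
  proof -
    have "S = infsum g ({0..t - 1} \<union> {t..})"
      unfolding S_def using that by (intro infsum_cong_neutral) (auto simp: causal)
    also have "\<dots> = infsum g {0..t - 1} + infsum g {t..}"
      by (intro infsum_Un_disjoint summable_on_subset_banach[OF summable]) auto
    finally show ?thesis by simp
  qed
  have "\<forall>\<^sub>F F in finite_subsets_at_top UNIV. S / 2 < sum g F"
    using has_sum_infsum[OF summable] \<open>0 < S\<close> unfolding has_sum_def S_def
    by (intro order_tendstoD) auto
  then obtain F where F: "finite F" "S / 2 < sum g F"
    unfolding eventually_finite_subsets_at_top by auto
  define t where "t = Max (insert 0 F) + 1"
  have Ft: "k < t" if "k \<in> insert 0 F" for k
    using Max_ge[of "insert 0 F" k] F that by (simp add: t_def)
  have "0 \<le> t" using Ft[of 0] by simp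
  have "sum g F \<le> (\<Sum>k\<in>{0..t - 1}. g k)"
  proof -
    have "sum g F = (\<Sum>k\<in>F \<inter> {0..}. g k)"
      using F causal by (intro sum.mono_neutral_right) (auto simp flip: linorder_not_less)
    also have "\<dots> \<le> (\<Sum>k\<in>{0..t - 1}. g k)"
      using Ft by (intro sum_mono2) (auto simp: nonneg)
    finally show ?thesis .
  qed
  then have "?Q t" using F split[OF \<open>0 \<le> t\<close>] \<open>0 \<le> t\<close> by simp
  then have ex: "\<exists>n. ?Q (int n)" by (metis int_nat_eq)
  define n where "n = (LEAST n. ?Q (int n))"
  have Qn: "?Q (int n)" unfolding n_def using ex by (rule LeastI_ex)
  have "settle_time g = int n"
    unfolding settle_time_def
  proof (rule Least_equality)
    fix s assume s: "?Q s"
    then have "?Q (int (nat s))" by simp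
    then have "n \<le> nat s" unfolding n_def by (rule Least_le)
    then show "int n \<le> s" using s by linarith
  qed (rule Qn)
  with Qn show ?nonneg ?ex by simp_all
qed

text \<open>After a run of ones as long as the settling time, the recent past outweighs the rest even
  if all earlier inputs equal \<open>-1\<close>.\<close>

lemma conv_pos_after_run:
  assumes x: "\<And>\<tau>. \<bar>x \<tau>\<bar> \<le> 1" and run: "\<And>k. 0 \<le> k \<Longrightarrow> k < settle_time g \<Longrightarrow> x (t - k) = 1"
  shows "0 < conv g x t"
proof -
  define n where "n = settle_time g"
  let ?f = "\<lambda>k. g k * x (t - k)"
  have summ: "?f summable_on A" for A
    by (rule summable_on_mult) (rule x)
  have "0 \<le> n" using settle_time_exceeds_tail by (simp add: n_def)
  have "0 < (\<Sum>k\<in>{0..n - 1}. g k) - (\<Sum>\<^sub>\<infinity>k\<in>{n..}. g k)"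
    using settle_time_exceeds_tail by (simp add: n_def)
  also have "\<dots> = (\<Sum>k\<in>{0..n - 1}. ?f k) + (\<Sum>\<^sub>\<infinity>k\<in>{n..}. - g k)"
    using run by (simp add: n_def infsum_uminus)
  also have "\<dots> \<le> (\<Sum>k\<in>{0..n - 1}. ?f k) + (\<Sum>\<^sub>\<infinity>k\<in>{n..}. ?f k)"
  proof (intro add_left_mono infsum_mono summ)
    show "(\<lambda>k. - g k) summable_on {n..}"
      using summable_on_mult[of "\<lambda>_. -1" "{n..}"] by simp
    show "- g k \<le> ?f k" for k
      using x[of "t - k"] nonneg[of k] mult_left_mono[of "-1" "x (t - k)" "g k"]
      by (simp add: abs_le_iff)
  qed
  also have "\<dots> = infsum ?f ({0..n - 1} \<union> {n..})"
    by (subst infsum_Un_disjoint) (auto intro: summ)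
  also have "\<dots> = conv g x t"
    unfolding conv_altdef using \<open>0 \<le> n\<close> by (intro infsum_cong_neutral) (auto simp: causal)
  finally show ?thesis .
qed

end

section \<open>Oscillations with two sign changes per period\<close>

text \<open>The assumption \<open>no_alternation\<close> is what the bound on the cyclic variation of the relay output
  provides. Stated for the signs at four places it is preserved by negating \<open>u\<close>, which halves
  the work: every fact about ones has a mirror image about minus ones.\<close>

locale relay_oscillation = decreasing_kernel +
  fixes \<chi> :: real and d P :: int and u :: "int \<Rightarrow> real"
  assumes threshold: "0 \<le> \<chi>"
    and delay: "1 \<le> d"
    and period: "periodic P u"
    and feedback: "relay_feedback g \<chi> d u"
    and nonzero: "\<exists>t. u t \<noteq> 0"
    and no_alternation: "\<lbrakk>a < b; b < c; c < e; e < a + P; 0 \<le> rel \<chi> (u a); rel \<chi> (u b) \<le> 0;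
      0 \<le> rel \<chi> (u c); rel \<chi> (u e) \<le> 0\<rbrakk> \<Longrightarrow> False"
begin

definition r :: "int \<Rightarrow> real" where
  "r t = rel \<chi> (u t)"

lemma r_cases: "r t = 1 \<or> r t = 0 \<or> r t = -1"
  by (simp add: r_def rel_def)

lemma r_abs: "\<bar>r t\<bar> \<le> 1"
  unfolding r_def by (rule abs_rel_le_1)

lemma P_pos: "0 < P"
  using period by (simp add: periodic_def)

lemma u_shift: "u (t + k * P) = u t"
  by (rule periodic_add_mult[OF period])

lemma r_shift: "r (t + k * P) = r t"
  by (simp add: r_def u_shift)

lemma r_add_P: "r (t + P) = r t" and r_diff_P: "r (t - P) = r t"
  using r_shift[of t 1] r_shift[of t "-1"] by simp_all

lemma u_eq_conv: "u t = - conv g r (t - d)"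
  using feedback unfolding relay_feedback_def r_def by blast

lemma r_alternation:
  assumes "a < b" "b < c" "c < e" "e < a + P" "0 \<le> r a" "r b \<le> 0" "0 \<le> r c" "r e \<le> 0"
  shows False
  using no_alternation[of a b c e] assms by (simp add: r_def)

lemma relay_oscillation_uminus: "relay_oscillation g \<chi> d P (\<lambda>t. - u t)"
proof unfold_locales
  fix a b c e
  assume "a < b" "b < c" "c < e" "e < a + P" "0 \<le> rel \<chi> (- u a)" "rel \<chi> (- u b) \<le> 0"
    "0 \<le> rel \<chi> (- u c)" "rel \<chi> (- u e) \<le> 0"
  \<comment> \<open>Negation reverses the pattern; starting it one place later restores it.\<close>
  then show False
    using r_alternation[of b c e "a + P"] r_add_P[of a] threshold by (simp add: rel_uminus r_def)
qed (use threshold delay period nonzero relay_feedback_uminus[OF threshold feedback] in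
  \<open>auto simp: periodic_def\<close>)

text \<open>Without ones the relay output would be nonpositive, so the negative feedback would make \<open>u\<close>
  and hence the relay output nonnegative; only \<open>u = 0\<close> remains.\<close>

lemma ex_r_eq_1: "\<exists>t. r t = 1"
proof (rule ccontr)
  assume "\<nexists>t. r t = 1"
  then have nonpos: "r t \<le> 0" for t
    using r_cases[of t] by auto
  have "u t \<ge> 0" for t
  proof -
    have "0 \<le> conv g (\<lambda>\<tau>. - r \<tau>) (t - d)"
      unfolding conv_altdef by (rule infsum_nonneg) (simp add: mult_nonneg_nonpos nonneg nonpos)
    then show ?thesis using u_eq_conv[of t] by (simp add: conv_uminus)
  qed
  then have "r t \<ge> 0" for t
    using threshold by (simp add: r_def rel_def) (metis dual_order.trans neg_le_0_iff_le not_less)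
  then have "r = (\<lambda>_. 0)"
    using nonpos by (intro ext antisym) auto
  then have "u t = 0" for t
    using u_eq_conv[of t] by (simp add: conv_def)
  then show False using nonzero by blast
qed

end

text \<open>An interpretation mirrors only what has been proved before it. The context is therefore
  entered twice: first to mirror the existence of ones, later to mirror peaks and runs.\<close>

context relay_oscillation
begin

interpretation neg: relay_oscillation g \<chi> d P "\<lambda>t. - u t"
  by (rule relay_oscillation_uminus)

lemma neg_r: "neg.r t = - r t"
  using threshold by (simp add: neg.r_def r_def rel_uminus)

lemma ex_r_eq_neg1: "\<exists>t. r t = -1"
  using neg.ex_r_eq_1 unfolding neg_r by (metis minus_equation_iff)

lemma conv_less:
  assumes "r t = 1"
  shows "conv g r (t - 1) < conv g r t"
proof -
  obtain q where q: "r q = -1" using ex_r_eq_neg1 by blast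
  obtain k where "t - P \<le> q + k * P" "q + k * P < t - P + P"
    using shift_into_period[OF P_pos] .
  then show ?thesis
    using q assms r_abs
    by (intro conv_less_at_max[where q = "q + k * P"]) (auto simp: r_shift abs_le_iff)
qed

lemma conv_greater:
  assumes "r t = -1"
  shows "conv g r t < conv g r (t - 1)"
proof -
  obtain q where q: "r q = 1" using ex_r_eq_1 by blast
  obtain k where "t - P \<le> q + k * P" "q + k * P < t - P + P"
    using shift_into_period[OF P_pos] .
  moreover have "-1 \<le> r \<tau>" for \<tau> using r_abs[of \<tau>] by (simp add: abs_le_iff)
  ultimately show ?thesis
    using q assms r_abs
    by (intro conv_greater_at_min[where q = "q + k * P"]) (auto simp: r_shift)
qed

text \<open>Take \<open>T\<close> to be a maximum of \<open>u\<close>. There the relay is on; and because \<open>u\<close> is the delayed negative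
  output, it falls as long as the delayed relay equals 1 and rises as long as it equals -1. Neither
  a fall into \<open>T\<close> nor a rise out of it is possible, which determines the signs of the relay output
  at \<open>T - d\<close> and \<open>T - d + 1\<close>.\<close>

lemma ex_peak: "\<exists>T. r T = 1 \<and> r (T - d) \<le> 0 \<and> 0 \<le> r (T - d + 1)"
proof -
  have "finite (u ` {0..<P})" "u ` {0..<P} \<noteq> {}" using P_pos by auto
  then have "Max (u ` {0..<P}) \<in> u ` {0..<P}" by (rule Max_in)
  then obtain T where T: "u T = Max (u ` {0..<P})" by auto
  have max: "u t \<le> u T" for t
  proof -
    obtain k where "0 \<le> t + k * P" "t + k * P < 0 + P"
      using shift_into_period[OF P_pos] .
    then have "u (t + k * P) \<le> u T"
      unfolding T by (intro Max_ge) auto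
    then show ?thesis by (simp add: u_shift)
  qed
  obtain x where "r x = 1" using ex_r_eq_1 by blast
  then have "r T = 1"
    using max[of x] by (auto simp: r_def rel_def split: if_splits)
  moreover have "r (T - d) \<noteq> 1"
  proof
    assume "r (T - d) = 1"
    then have "u T < u (T - 1)"
      using conv_less[of "T - d"] u_eq_conv[of T] u_eq_conv[of "T - 1"] by (simp add: algebra_simps)
    then show False using max[of "T - 1"] by simp
  qed
  moreover have "r (T - d + 1) \<noteq> -1"
  proof
    assume "r (T - d + 1) = -1"
    then have "u T < u (T + 1)"
      using conv_greater[of "T - d + 1"] u_eq_conv[of T] u_eq_conv[of "T + 1"]
      by (simp add: algebra_simps)
    then show False using max[of "T + 1"] by simp
  qed
  ultimately show ?thesis
    using r_cases[of "T - d"] r_cases[of "T - d + 1"] by auto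
qed

lemma ex_run_start: "\<exists>p. r p = 1 \<and> r (p - 1) \<le> 0"
proof -
  obtain x y where x: "r x = 1" and y: "r y = -1" using ex_r_eq_1 ex_r_eq_neg1 by blast
  obtain k where "x - P \<le> y + k * P" "y + k * P < x - P + P"
    using shift_into_period[OF P_pos] .
  then have ex: "\<exists>n. r (x - int n) \<noteq> 1"
    using y r_shift[of y k] by (intro exI[of _ "nat (x - (y + k * P))"]) simp
  define n where "n = (LEAST n. r (x - int n) \<noteq> 1)"
  have n: "r (x - int n) \<noteq> 1" unfolding n_def using ex by (rule LeastI_ex)
  then have "n \<noteq> 0" using x by (cases n) auto
  then have "r (x - int (n - 1)) = 1"
    using not_less_Least[of "n - 1" "\<lambda>n. r (x - int n) \<noteq> 1"] by (simp add: n_def)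
  moreover have "x - int (n - 1) - 1 = x - int n" using \<open>n \<noteq> 0\<close> by simp
  ultimately show ?thesis
    using n r_cases[of "x - int n"] by (metis order_refl zero_le_one neg_le_0_iff_le)
qed

text \<open>If the relay were on for \<open>settle_time g + d\<close> steps, then after the first \<open>settle_time g\<close> of
  them the output would be positive, so after \<open>d\<close> more \<open>u\<close> would be negative: within the run itself.\<close>

lemma run_end:
  assumes "r p = 1"
  shows "\<exists>q. p < q \<and> q < p + settle_time g + d \<and> r q \<le> 0 \<and> (\<forall>t. p \<le> t \<and> t < q \<longrightarrow> r t = 1)"
proof -
  define N where "N = settle_time g + d"
  have N: "0 < N" using settle_time_exceeds_tail(1) delay by (simp add: N_def)
  have ex: "\<exists>n. int n < N \<and> r (p + int n) \<noteq> 1"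
  proof (rule ccontr)
    assume "\<not> ?thesis"
    then have run: "r (p + int n) = 1" if "int n < N" for n using that by blast
    have run': "r t = 1" if "p \<le> t" "t < p + N" for t
      using run[of "nat (t - p)"] that by simp
    have "0 < conv g r (p + settle_time g - 1)"
    proof (rule conv_pos_after_run)
      show "r (p + settle_time g - 1 - k) = 1" if "0 \<le> k" "k < settle_time g" for k
        using run'[of "p + settle_time g - 1 - k"] that delay by (simp add: N_def)
    qed (rule r_abs)
    then have "u (p + N - 1) < 0"
      using u_eq_conv[of "p + N - 1"] by (simp add: N_def algebra_simps)
    then have "r (p + N - 1) \<noteq> 1" using threshold by (simp add: r_def rel_def)
    with run'[of "p + N - 1"] N show False by simp
  qed
  define n where "n = (LEAST n. int n < N \<and> r (p + int n) \<noteq> 1)"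
  have n: "int n < N" "r (p + int n) \<noteq> 1"
    using LeastI_ex[OF ex] by (simp_all add: n_def)
  have "r t = 1" if "p \<le> t" "t < p + int n" for t
    using not_less_Least[of "nat (t - p)" "\<lambda>n. int n < N \<and> r (p + int n) \<noteq> 1"] n(1) that
    by (auto simp: n_def nat_less_iff)
  moreover have "n \<noteq> 0" using n(2) assms by (cases n) auto
  moreover have "r (p + int n) \<le> 0" using n(2) r_cases[of "p + int n"] by auto
  ultimately show ?thesis
    using n(1) by (intro exI[of _ "p + int n"]) (auto simp: N_def)
qed

end

context relay_oscillation
begin

interpretation neg: relay_oscillation g \<chi> d P "\<lambda>t. - u t"
  by (rule relay_oscillation_uminus)

text \<open>The peak \<open>T\<close> is preceded, \<open>d\<close> steps earlier, by a switch of the relay output from \<open>\<le> 0\<close> to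
  \<open>\<ge> 0\<close>, and the trough \<open>S\<close> by a switch in the other direction. If twice the delay exceeded
  the period, one of these two pieces of length \<open>d\<close> would reach back beyond the preceding extremum,
  and its switch together with the two extrema would form a forbidden alternation.\<close>

lemma period_lower_bound:
  assumes "d \<le> P"
  shows "2 * d \<le> P"
proof (rule ccontr)
  assume less: "\<not> 2 * d \<le> P"
  obtain T where T: "r T = 1" "r (T - d) \<le> 0" "0 \<le> r (T - d + 1)"
    using ex_peak by blast
  obtain S' where S': "r S' = -1" "0 \<le> r (S' - d)" "r (S' - d + 1) \<le> 0"
    using neg.ex_peak unfolding neg_r by (metis minus_equation_iff neg_0_le_iff_le neg_le_0_iff_le)
  obtain k where k: "T \<le> S' + k * P" "S' + k * P < T + P"
    using shift_into_period[OF P_pos] .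
  define S where "S = S' + k * P"
  have S: "r S = -1" "0 \<le> r (S - d)" "r (S - d + 1) \<le> 0"
    using S' r_shift[of S' k] r_shift[of "S' - d" k] r_shift[of "S' - d + 1" k]
    by (simp_all add: S_def algebra_simps)
  have TS: "T < S" "S < T + P"
    using k S(1) T(1) by (auto simp: S_def order_le_less)
  have "d \<noteq> P" using r_diff_P[of T] T by auto
  \<comment> \<open>Either the piece ending at the trough \<open>S\<close> reaches back beyond the peak \<open>T\<close>, or the piece
    ending at the next peak \<open>T + P\<close> reaches back beyond \<open>S\<close>.\<close>
  consider "S - d < T" | "T + P - d < S" using less by linarith
  then show False
  proof cases
    case 1
    moreover have "S - d + 1 \<noteq> T" using S T by auto
    ultimately show False
      using r_alternation[of "S - d" "S - d + 1" T S] S T TS \<open>d \<noteq> P\<close> assms by simp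
  next
    case 2
    moreover have "T + P - d + 1 \<noteq> S"
      using S T r_add_P[of "T - d + 1"] by (auto simp: algebra_simps)
    ultimately show False
      using r_alternation[of "T + P - d + 1" S "T + P" "T + P - d + P"] S T TS \<open>d \<noteq> P\<close> assms
        r_add_P[of "T - d + 1"] r_add_P[of T] r_shift[of "T - d" 2] by (simp add: algebra_simps)
  qed
qed

text \<open>A period consists of one run of ones, one run of minus ones, and what lies between them.
  A run has at most \<open>settle_time g + d - 1\<close> entries, and each gap at most one: a longer gap
  after the ones would begin with an entry \<open>\<le> 0\<close> and end with a later entry \<open>\<ge> 0\<close> before the minus
  ones, a forbidden alternation.\<close>

lemma period_upper_bound: "P \<le> 2 * (d + settle_time g)"
proof -
  obtain p where p: "r p = 1" "r (p - 1) \<le> 0" using ex_run_start by blast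
  obtain p0 where p0: "r p0 = -1" "0 \<le> r (p0 - 1)"
    using neg.ex_run_start unfolding neg_r by (metis minus_equation_iff neg_le_0_iff_le)
  obtain k where k: "p \<le> p0 + k * P" "p0 + k * P < p + P"
    using shift_into_period[OF P_pos] .
  define p' where "p' = p0 + k * P"
  have p': "r p' = -1" "0 \<le> r (p' - 1)"
    using p0 r_shift[of p0 k] r_shift[of "p0 - 1" k] by (simp_all add: p'_def algebra_simps)
  have pp': "p < p'" "p' < p + P" using k p p' by (auto simp: p'_def order_le_less)
  obtain q where q: "p < q" "q < p + settle_time g + d" "r q \<le> 0"
    and run: "\<And>t. p \<le> t \<Longrightarrow> t < q \<Longrightarrow> r t = 1"
    using run_end[OF p(1)] by blast
  have "neg.r p' = 1" using p' by (simp add: neg_r)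
  from neg.run_end[OF this] obtain q' where q': "p' < q'" "q' < p' + settle_time g + d" "0 \<le> r q'"
    and run': "\<And>t. p' \<le> t \<Longrightarrow> t < q' \<Longrightarrow> r t = -1"
    unfolding neg_r by (metis minus_equation_iff neg_le_0_iff_le)
  have pP: "r (p + P) = 1" "r (p + P - 1) \<le> 0"
    using p r_add_P[of p] r_add_P[of "p - 1"] by (simp_all add: algebra_simps)
  have "q \<le> p'" using run[of p'] p' pp' by fastforce
  have "q' \<le> p + P" using run'[of "p + P"] pP pp' by fastforce
  \<comment> \<open>The gaps are the intervals from \<open>q\<close> to \<open>p'\<close> and from \<open>q'\<close> to \<open>p + P\<close>.\<close>
  have "p' \<le> q + 1"
    using r_alternation[of p q "p' - 1" p'] p p' pp' q by fastforce
  have "p + P \<le> q' + 1"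
    using r_alternation[of q' "p + P - 1" "p + P" "p' + P"] pP p' pp' q' r_add_P[of p'] by fastforce
  then show ?thesis
    using \<open>p' \<le> q + 1\<close> q(2) q'(2) zless_imp_add1_zle[OF q(2)] zless_imp_add1_zle[OF q'(2)]
    by (simp add: algebra_simps)
qed

end

section \<open>The square wave of half period equal to the delay\<close>

lemma square_wave_antiperiodic:
  assumes per: "periodic (2 * d) s" and s: "\<forall>t\<in>{0..d - 1}. s t = 1" "\<forall>t\<in>{d..2 * d - 1}. s t = -1"
  shows "s (t + d) = - s t"
proof -
  have "0 < 2 * d" using per by (simp add: periodic_def)
  then obtain k where k: "0 \<le> t + k * (2 * d)" "t + k * (2 * d) < 0 + 2 * d"
    using shift_into_period by blast
  define t' where "t' = t + k * (2 * d)"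
  have t': "0 \<le> t'" "t' < 2 * d" using k by (simp_all add: t'_def)
  have 1: "s t' = s t" "s (t' + d) = s (t + d)"
    using periodic_add_mult[OF per, of t k] periodic_add_mult[OF per, of "t + d" k]
    by (simp_all add: t'_def algebra_simps)
  have "s (t' + d) = - s t'"
  proof (cases "t' < d")
    case True
    then show ?thesis using t' s by auto
  next
    case False
    have "s (t' + d) = s (t' - d)"
      using periodic_add_mult[OF per, of "t' - d" 1] by (simp add: algebra_simps)
    then show ?thesis using False t' s by auto
  qed
  then show ?thesis using 1 by simp
qed

context decreasing_kernel
begin

text \<open>The square wave \<open>s\<close> changes sign under a shift by \<open>d\<close>, so a delayed negative feedback of \<open>s\<close>
  is the plain output \<open>conv g s\<close>: it is the only candidate for \<open>u\<close>. This output rises as long as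
  \<open>s\<close> equals 1, so that it stays above the threshold on \<open>{0..<d}\<close> if and only if it starts above it;
  the other half of the period follows by antisymmetry.\<close>

lemma square_wave_oscillation_iff:
  assumes per: "periodic (2 * d) s" and s: "\<forall>t\<in>{0..d - 1}. s t = 1" "\<forall>t\<in>{d..2 * d - 1}. s t = -1"
    and \<chi>: "0 \<le> \<chi>"
  shows "(\<exists>u. self_oscillation g \<chi> d (2 * d) u \<and> (\<forall>t. rel \<chi> (u t) = s t)) \<longleftrightarrow> \<chi> < conv g s 0"
proof
  have d: "0 < d" using per by (simp add: periodic_def)
  have anti: "s (t + d) = - s t" for t
    using per s by (rule square_wave_antiperiodic)
  have conv_anti: "conv g s (t + d) = - conv g s t" for t
    using conv_shift[of g s d t] by (simp only: anti conv_uminus)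
  {
    assume "\<exists>u. self_oscillation g \<chi> d (2 * d) u \<and> (\<forall>t. rel \<chi> (u t) = s t)"
    then obtain u where fb: "relay_feedback g \<chi> d u" and u: "\<And>t. rel \<chi> (u t) = s t"
      by (auto simp: self_oscillation_def)
    have "u 0 = - conv g s (0 - d)"
      using fb unfolding relay_feedback_def u by blast
    also have "\<dots> = conv g s 0" using conv_anti[of "- d"] by simp
    finally have "u 0 = conv g s 0" .
    moreover have "rel \<chi> (u 0) = 1" using u[of 0] s d by simp
    ultimately show "\<chi> < conv g s 0" by (simp add: rel_def split: if_splits)
  }
  {
    assume above: "\<chi> < conv g s 0"
    define u where "u = conv g s"
    have per_u: "periodic (2 * d) u"
      unfolding u_def using per by (rule periodic_conv)
    have s_cases: "s t = 1 \<or> s t = -1" for t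
    proof -
      have "s (t mod (2 * d)) = s t" by (rule periodic_mod[OF per])
      moreover have "0 \<le> t mod (2 * d)" "t mod (2 * d) < 2 * d" using d by simp_all
      ultimately show ?thesis using s by (cases "t mod (2 * d) < d") auto
    qed
    have rise: "u (t - 1) < u t" if "s t = 1" for t
    proof -
      have "s (t - d) = -1" using anti[of "t - d"] that by simp
      moreover have "\<bar>s \<tau>\<bar> \<le> 1" "s \<tau> \<le> 1" for \<tau> using s_cases[of \<tau>] by auto
      ultimately show ?thesis
        unfolding u_def using that d by (intro conv_less_at_max[of s t "t - d"]) auto
    qed
    have high: "\<chi> < u t" if "0 \<le> t" "t < d" for t
      using that
    proof (induction t rule: int_ge_induct)
      case base
      then show ?case using above by (simp add: u_def)
    next
      case (step t)
      then have "u t < u (t + 1)" using rise[of "t + 1"] s by simp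
      then show ?case using step by simp
    qed
    have u_anti: "u (t + d) = - u t" for t using conv_anti by (simp add: u_def)
    have rel_u: "rel \<chi> (u t) = s t" for t
    proof -
      define t' where "t' = t mod (2 * d)"
      have t': "0 \<le> t'" "t' < 2 * d" using d by (simp_all add: t'_def)
      have "rel \<chi> (u t') = s t'"
      proof (cases "t' < d")
        case True
        then show ?thesis using high[of t'] t' s by (simp add: rel_def)
      next
        case False
        then have "u t' < - \<chi>" using high[of "t' - d"] u_anti[of "t' - d"] t' by simp
        then show ?thesis using \<chi> False t' s by (simp add: rel_def)
      qed
      then show ?thesis
        unfolding t'_def by (simp only: periodic_mod[OF per_u] periodic_mod[OF per])
    qed
    have "relay_feedback g \<chi> d u"
      unfolding relay_feedback_def rel_u
    proof
      show "u t = - conv g s (t - d)" for t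
        using u_anti[of "t - d"] by (simp add: u_def)
    qed
    moreover have "2 \<le> cvar_minus (cyc_diff (trunc (2 * d) u))"
      \<comment> \<open>The output turns down after the last 1 and up after the last -1 of a period.\<close>
    proof (rule cvar_minus_cyc_diff_trunc_ge[OF per_u, of "d - 1" "2 * d - 1"])
      have "u (-1) < u 0" using rise[of 0] s d by simp
      moreover have "u (d - 1) = - u (-1)" "u d = - u 0"
        using u_anti[of "-1"] u_anti[of 0] by simp_all
      moreover have "u (2 * d - 1) = u (-1)" "u (2 * d) = u 0"
        using periodic_add_mult[OF per_u, of "-1" 1] periodic_add_mult[OF per_u, of 0 1]
        by simp_all
      ultimately show "u (d - 1 + 1) < u (d - 1)" "u (2 * d - 1) < u (2 * d - 1 + 1)"
        by simp_all
    qed (use d in simp_all)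
    ultimately have "self_oscillation g \<chi> d (2 * d) u"
      using per_u by (simp add: self_oscillation_def)
    then show "\<exists>u. self_oscillation g \<chi> d (2 * d) u \<and> (\<forall>t. rel \<chi> (u t) = s t)"
      using rel_u by blast
  }
qed

end

section \<open>Period bounds and the fastest oscillation\<close>

theorem theorem4:
  fixes P\<^sub>d :: int and \<chi>\<^sub>0 :: real and g\<^sub>0 :: "int \<Rightarrow> real"
  assumes "P\<^sub>d \<ge> 1"
    and "\<chi>\<^sub>0 \<ge> 0"
    and "\<And>t. t < 0 \<Longrightarrow> g\<^sub>0 t = 0"
    and "g\<^sub>0 0 > 0"
    and "(\<lambda>t. \<bar>g\<^sub>0 t\<bar>) summable_on UNIV"
    and "supp g\<^sub>0 = {0..}"
    and "strict_antimono_on (supp g\<^sub>0) g\<^sub>0"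
  shows "(\<forall>P u. self_oscillation g\<^sub>0 \<chi>\<^sub>0 P\<^sub>d P u \<and> P \<ge> P\<^sub>d
            \<and> cvar_minus (cyc_diff (trunc P u)) = 2
            \<and> cvar_plus (map (rel \<chi>\<^sub>0) (trunc P u)) = 2
          \<longrightarrow> 2 * P\<^sub>d \<le> P \<and> P \<le> 2 * (P\<^sub>d + settle_time g\<^sub>0))
       \<and> (\<forall>s. periodic (2 * P\<^sub>d) s \<and> (\<forall>t\<in>{0..P\<^sub>d - 1}. s t = 1)
            \<and> (\<forall>t\<in>{P\<^sub>d..2 * P\<^sub>d - 1}. s t = -1)
          \<longrightarrow> ((\<exists>u. self_oscillation g\<^sub>0 \<chi>\<^sub>0 P\<^sub>d (2 * P\<^sub>d) u \<and> (\<forall>t. rel \<chi>\<^sub>0 (u t) = s t))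
               \<longleftrightarrow> conv g\<^sub>0 s 0 > \<chi>\<^sub>0))"
proof -
  have kernel: "decreasing_kernel g\<^sub>0"
  proof
    show "g\<^sub>0 summable_on UNIV"
      using assms(5) unfolding real_norm_def[symmetric]
      by (rule summable_on_iff_abs_summable_on_real[THEN iffD2])
    show "g\<^sub>0 (t + 1) < g\<^sub>0 t" if "0 \<le> t" for t
    proof -
      have "t \<in> supp g\<^sub>0" "t + 1 \<in> supp g\<^sub>0" using that by (simp_all add: assms(6))
      then show ?thesis by (rule monotone_onD[OF assms(7)]) simp
    qed
  qed (rule assms(3))
  have bounds: "2 * P\<^sub>d \<le> P \<and> P \<le> 2 * (P\<^sub>d + settle_time g\<^sub>0)"
    if osc: "self_oscillation g\<^sub>0 \<chi>\<^sub>0 P\<^sub>d P u" and "P\<^sub>d \<le> P"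
      and two: "cvar_plus (map (rel \<chi>\<^sub>0) (trunc P u)) = 2" for P u
  proof -
    have per: "periodic P u" and fb: "relay_feedback g\<^sub>0 \<chi>\<^sub>0 P\<^sub>d u"
      and var: "2 \<le> cvar_minus (cyc_diff (trunc P u))"
      using osc by (simp_all add: self_oscillation_def)
    have "0 < P" using per by (simp add: periodic_def)
    define r where "r = (\<lambda>t. rel \<chi>\<^sub>0 (u t))"
    have per_r: "periodic P r" using per by (simp add: periodic_def r_def)
    have two_r: "cvar_plus (trunc P r) = 2" using two by (simp add: trunc_def r_def comp_def)
    have "relay_oscillation g\<^sub>0 \<chi>\<^sub>0 P\<^sub>d P u"
    proof (intro relay_oscillation.intro relay_oscillation_axioms.intro)
      show "\<exists>t. u t \<noteq> 0"
      proof (rule ccontr)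
        assume "\<nexists>t. u t \<noteq> 0"
        then have "cvar_minus (cyc_diff (trunc P u)) = -1"
          using \<open>0 < P\<close> by (intro cvar_minus_cyc_diff_trunc_zero) auto
        then show False using var by simp
      qed
      show False if "a < b" "b < c" "c < e" "e < a + P" "0 \<le> rel \<chi>\<^sub>0 (u a)" "rel \<chi>\<^sub>0 (u b) \<le> 0"
        "0 \<le> rel \<chi>\<^sub>0 (u c)" "rel \<chi>\<^sub>0 (u e) \<le> 0" for a b c e
        using cvar_plus_trunc_ge_of_alternation[OF per_r _ that(1-4), of 1] that(5-8) two_r
        by (simp add: r_def)
    qed (fact kernel assms(1) assms(2) per fb)+
    then interpret relay_oscillation g\<^sub>0 \<chi>\<^sub>0 P\<^sub>d P u .
    show ?thesis
      using period_lower_bound[OF \<open>P\<^sub>d \<le> P\<close>] period_upper_bound by (rule conjI)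
  qed
  show ?thesis
  proof (intro conjI allI impI)
    fix P u
    assume "self_oscillation g\<^sub>0 \<chi>\<^sub>0 P\<^sub>d P u \<and> P \<ge> P\<^sub>d
      \<and> cvar_minus (cyc_diff (trunc P u)) = 2 \<and> cvar_plus (map (rel \<chi>\<^sub>0) (trunc P u)) = 2"
    then show "2 * P\<^sub>d \<le> P" "P \<le> 2 * (P\<^sub>d + settle_time g\<^sub>0)"
      using bounds[of P u] by simp_all
  qed (elim conjE, rule decreasing_kernel.square_wave_oscillation_iff[OF kernel _ _ _ assms(2)])
qed

end
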